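(* Consider the problem $\min_{x\in S} f(x)$, where $S\subset\mathbb{R}^d$ is either a continuous (real-valued) compact domain or a finite domain. Suppose that the adaptive subregion probabilities used by BASSO satisfy Assumption 1 and that the surrogate sampling satisfies Assumption 2 (both stated in the context). Let $Y^{\mathrm{surr}}_k$ and $Y^{\mathrm{unif}}_k$ be the incumbent values at iteration $k$ of BASSO with surrogate sampling within subregions and of BASSO with uniform sampling within subregions, respectively, using the same subregions and subregion probabilities. Then $Y^{\mathrm{surr}}$ stochastically dominates $Y^{\mathrm{unif}}$, i.e. $$P\left(Y^{\mathrm{surr}}_k\le y\right)\ \ge\ P\left(Y^{\mathrm{unif}}_k\le y\right)$$ for all $k=0,1,2,\ldots$ and all $y$ with $y_*<y\le y^*$.
   Context: Setting. $S\subset\mathbb{R}^d$ is compact (continuous or finite), and $f:S\to\mathbb{R}$ is a (measurable) function attaining its minimum $y_*=\min_S f$ at a unique point $x_*$ and its maximum $y^*=\max_S f$. The size $v_A$ of a (measurable) set $A\subset S$ is its $d$-dimensional volume when $S$ is continuous (with $0<v_S<\infty$) and its number of points when $S$ is finite. For $A\subset S$ and a real number $y$, write $v_A(y)$ for the size of $\{x\in A: f(x)\le y\}$. Subregions. For each iteration $k=0,1,2,\ldots$ there is given a partition of $S$ into finitely many mutually exclusive subregions $\sigma^{(k)}_1,\ldots,\sigma^{(k)}_{m_k}$ of positive size with union $S$, together with (measurable) functions $\tilde p^{(k)}_i(t)$, $i=1,\dots,m_k$, $y_*<t\le y^*$; $\tilde p^{(k)}_i(t)$ is the probability of selecting subregion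 $i$ at iteration $k$ when the parameter (incumbent value) equals $t$. The partitions and the probability functions are regarded as given at each iteration. Below the superscript $(k)$ is dropped. Assumption 1. For every $k$: (1) $0\le\tilde p_i(t)\le1$ for all $i$ and $y_*<t\le y^*$; (2) $\sum_{i=1}^{m_k}\tilde p_i(t)=1$ for all $y_*<t\le y^*$; (3) for all $t_z,t_{z'}$ with $y_*<t_z\le t_{z'}\le y^*$ and all $y,z$ with $y_*<y\le z\le y^*$, $$\frac{\sum_{i=1}^{m_k}\frac{\tilde p_i(t_z)}{v_{\sigma_i}}v_{\sigma_i}(y)}{\sum_{i=1}^{m_k}\frac{\tilde p_i(t_z)}{v_{\sigma_i}}v_{\sigma_i}(z)}\ \ge\ \frac{\sum_{i=1}^{m_k}\frac{\tilde p_i(t_{z'})}{v_{\sigma_i}}v_{\sigma_i}(y)}{\sum_{i=1}^{m_k}\frac{\tilde p_i(t_{z'})}{v_{\sigma_i}}v_{\sigma_i}(z)},$$ where the denominators are understood to be positive. BASSO. The initial value is $Y_0=f(X_0)$ with $X_0$ uniform on $S$. Each iteration makes one function evaluation: given $Y_k=z$, a subregion $\sigma_i$ is selected with probability $\tilde p_i(z)$, a point $X\in\sigma_i$ is generated, and $Y_{k+1}=\min(z,f(X))$. In the uniform version ($Y^{\mathrm{unif}}$) $X$ is uniformly distributed on $\sigma_i$. In the surrogate version ($Y^{\mathrm{surr}}$) $X\in\sigma_i$ is generated by some surrogate-model-based sampling procedure. In both versions $$P(Y_{k+1}\le y\mid Y_k=z)=\sum_{i=1}^{m_k}\tilde p_i(z)\,P(Y_{k+1}\le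 y\mid Y_k=z,\ X\in\sigma_i)\quad (y_*<z\le y^* ),$$ the conditional probability equals $1$ for $y\ge z$, and in the uniform version $P(Y^{\mathrm{unif}}_{k+1}\le y\mid Y^{\mathrm{unif}}_k=z,\ X\in\sigma_i)=v_{\sigma_i}(y)/v_{\sigma_i}$ for $y<z$. (If the current value is $y_*$, the process stays there.) Assumption 2. For every $k$ and every $i=1,\dots,m_k$: (1) for $y_*<y\le z\le y^*$, $$P(Y^{\mathrm{surr}}_{k+1}\le y\mid Y^{\mathrm{surr}}_k=z,\ X^{\mathrm{surr}}\in\sigma_i)\ \ge\ P(Y^{\mathrm{unif}}_{k+1}\le y\mid Y^{\mathrm{unif}}_k=z,\ X^{\mathrm{unif}}\in\sigma_i);$$ (2) for $y_*<y\le z\le z'\le y^*$, $$P(Y^{\mathrm{surr}}_{k+1}\le y\mid Y^{\mathrm{surr}}_k=z,\ X^{\mathrm{surr}}\in\sigma_i)\ \ge\ P(Y^{\mathrm{surr}}_{k+1}\le y\mid Y^{\mathrm{surr}}_k=z',\ X^{\mathrm{surr}}\in\sigma_i).$$ *)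

theory Defs
  imports "HOL-Probability.Probability"
begin

text \<open>
  The reference measure on the domain: counting measure for a finite domain, Lebesgue measure
  (on Borel sets) otherwise. In both cases its space is the domain itself, and a finite domain
  carries all its subsets as measurable sets.
\<close>

definition size_measure :: "'a::euclidean_space set \<Rightarrow> 'a measure" where
  "size_measure S = (if finite S then count_space S else restrict_space lborel S)"

definition size_of :: "'a::euclidean_space set \<Rightarrow> 'a set \<Rightarrow> real" where
  "size_of S A = measure (size_measure S) A"

definition size_below :: "'a::euclidean_space set \<Rightarrow> ('a \<Rightarrow> real) \<Rightarrow> 'a set \<Rightarrow> real \<Rightarrow> real" where
  "size_below S f A y = size_of S {x \<in> A. f x \<le> y}"

lemma size_of_finite: "finite S \<Longrightarrow> A \<subseteq> S \<Longrightarrow> size_of S A = card A"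
  by (simp add: size_of_def size_measure_def measure_count_space finite_subset)

lemma size_of_continuous:
  "infinite S \<Longrightarrow> S \<in> sets borel \<Longrightarrow> A \<subseteq> S \<Longrightarrow> size_of S A = measure lborel A"
  by (simp add: size_of_def size_measure_def measure_restrict_space)

definition search_domain :: "'a::euclidean_space set \<Rightarrow> bool" where
  "search_domain S \<longleftrightarrow>
     finite S \<and> S \<noteq> {} \<or>
     compact S \<and> 0 < emeasure lborel S \<and> emeasure lborel S < \<infinity>"

definition objective ::
  "'a::euclidean_space set \<Rightarrow> ('a \<Rightarrow> real) \<Rightarrow> 'a \<Rightarrow> real \<Rightarrow> real \<Rightarrow> bool" where
  "objective S f xmin ymin ymax \<longleftrightarrow>
     f \<in> borel_measurable (size_measure S) \<and>
     xmin \<in> S \<and> f xmin = ymin \<and> (\<forall>x\<in>S. x \<noteq> xmin \<longrightarrow> ymin < f x) \<and>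
     (\<exists>x\<in>S. f x = ymax) \<and> (\<forall>x\<in>S. f x \<le> ymax)"

text \<open>The subregions of iteration \<open>k\<close> are \<open>\<sigma> k 1, \<dots>, \<sigma> k (m k)\<close>.\<close>

definition subregions ::
  "'a::euclidean_space set \<Rightarrow> (nat \<Rightarrow> nat) \<Rightarrow> (nat \<Rightarrow> nat \<Rightarrow> 'a set) \<Rightarrow> bool" where
  "subregions S m \<sigma> \<longleftrightarrow> (\<forall>k.
     (\<forall>i\<in>{1..m k}. \<sigma> k i \<in> sets (size_measure S) \<and> 0 < size_of S (\<sigma> k i)) \<and>
     disjoint_family_on (\<sigma> k) {1..m k} \<and>
     (\<Union>i\<in>{1..m k}. \<sigma> k i) = S)"

text \<open>
  The probability that, with parameter \<open>t\<close>, one draw at iteration \<open>k\<close> that is uniform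
  within the selected subregion has value at most \<open>y\<close>.
\<close>

definition mixture_cdf ::
  "'a::euclidean_space set \<Rightarrow> ('a \<Rightarrow> real) \<Rightarrow> (nat \<Rightarrow> nat) \<Rightarrow> (nat \<Rightarrow> nat \<Rightarrow> 'a set) \<Rightarrow>
   (nat \<Rightarrow> nat \<Rightarrow> real \<Rightarrow> real) \<Rightarrow> nat \<Rightarrow> real \<Rightarrow> real \<Rightarrow> real" where
  "mixture_cdf S f m \<sigma> p k t y =
     (\<Sum>i = 1..m k. p k i t / size_of S (\<sigma> k i) * size_below S f (\<sigma> k i) y)"

text \<open>
  The ratio inequality is required only where both denominators are positive; elsewhere
  the quotients have no meaning (and division by zero would yield \<open>0\<close>).
\<close>

definition adaptive_probabilities ::
  "'a::euclidean_space set \<Rightarrow> ('a \<Rightarrow> real) \<Rightarrow> real \<Rightarrow> real \<Rightarrow>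
   (nat \<Rightarrow> nat) \<Rightarrow> (nat \<Rightarrow> nat \<Rightarrow> 'a set) \<Rightarrow> (nat \<Rightarrow> nat \<Rightarrow> real \<Rightarrow> real) \<Rightarrow> bool" where
  "adaptive_probabilities S f ymin ymax m \<sigma> p \<longleftrightarrow> (\<forall>k.
     (\<forall>i\<in>{1..m k}. p k i \<in> borel_measurable (restrict_space borel {ymin<..ymax})) \<and>
     (\<forall>i\<in>{1..m k}. \<forall>t\<in>{ymin<..ymax}. 0 \<le> p k i t \<and> p k i t \<le> 1) \<and>
     (\<forall>t\<in>{ymin<..ymax}. (\<Sum>i = 1..m k. p k i t) = 1) \<and>
     (\<forall>t t' y z. ymin < t \<and> t \<le> t' \<and> t' \<le> ymax \<and> ymin < y \<and> y \<le> z \<and> z \<le> ymax \<and>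
        0 < mixture_cdf S f m \<sigma> p k t z \<and> 0 < mixture_cdf S f m \<sigma> p k t' z \<longrightarrow>
        mixture_cdf S f m \<sigma> p k t y / mixture_cdf S f m \<sigma> p k t z \<ge>
        mixture_cdf S f m \<sigma> p k t' y / mixture_cdf S f m \<sigma> p k t' z))"

text \<open>
  A sampling rule \<open>Q\<close> gives, for each iteration \<open>k\<close>, subregion index \<open>i\<close> and incumbent value
  \<open>z\<close>, the conditional distribution \<open>Q k i z\<close> of the next sample given that the incumbent
  value is \<open>z\<close> and that subregion \<open>i\<close> was selected: a Markov kernel concentrated on \<open>\<sigma> k i\<close>.
\<close>

definition sampling_rule ::
  "'a::euclidean_space set \<Rightarrow> real \<Rightarrow> real \<Rightarrow> (nat \<Rightarrow> nat) \<Rightarrow> (nat \<Rightarrow> nat \<Rightarrow> 'a set) \<Rightarrow>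
   (nat \<Rightarrow> nat \<Rightarrow> real \<Rightarrow> 'a measure) \<Rightarrow> bool" where
  "sampling_rule S ymin ymax m \<sigma> Q \<longleftrightarrow> (\<forall>k. \<forall>i\<in>{1..m k}.
     Q k i \<in> restrict_space borel {ymin<..ymax} \<rightarrow>\<^sub>M prob_algebra (size_measure S) \<and>
     (\<forall>z\<in>{ymin<..ymax}. measure (Q k i z) (\<sigma> k i) = 1))"

definition uniform_rule ::
  "'a::euclidean_space set \<Rightarrow> (nat \<Rightarrow> nat \<Rightarrow> 'a set) \<Rightarrow> nat \<Rightarrow> nat \<Rightarrow> real \<Rightarrow> 'a measure" where
  "uniform_rule S \<sigma> k i z = uniform_measure (size_measure S) (\<sigma> k i)"

text \<open>
  The conditional probability that the next incumbent value is at most \<open>y\<close>, given that the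
  current one is \<open>z\<close> and that subregion \<open>i\<close> was selected.
\<close>

definition next_value_cdf ::
  "('a \<Rightarrow> real) \<Rightarrow> (nat \<Rightarrow> nat \<Rightarrow> real \<Rightarrow> 'a measure) \<Rightarrow> nat \<Rightarrow> nat \<Rightarrow> real \<Rightarrow> real \<Rightarrow> real" where
  "next_value_cdf f Q k i z y = \<P>(x in Q k i z. min z (f x) \<le> y)"

lemma next_value_cdf_ge:
  assumes "sampling_rule S ymin ymax m \<sigma> Q" "i \<in> {1..m k}" "z \<in> {ymin<..ymax}" "z \<le> y"
  shows "next_value_cdf f Q k i z y = 1"
proof -
  have "Q k i z \<in> space (prob_algebra (size_measure S))"
    using assms by (auto simp: sampling_rule_def space_restrict_space dest!: spec[of _ k] bspec[of _ _ i]
        intro: measurable_space)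
  then interpret prob_space "Q k i z" by (simp add: space_prob_algebra)
  show ?thesis using assms(4) by (simp add: next_value_cdf_def min_le_iff_disj prob_space)
qed

lemma next_value_cdf_uniform:
  assumes "subregions S m \<sigma>" "i \<in> {1..m k}" "f \<in> borel_measurable (size_measure S)" "y < z"
  shows "next_value_cdf f (uniform_rule S \<sigma>) k i z y =
           size_below S f (\<sigma> k i) y / size_of S (\<sigma> k i)"
proof -
  let ?N = "size_measure S"
  have \<sigma>: "\<sigma> k i \<in> sets ?N" and pos: "0 < measure ?N (\<sigma> k i)"
    using assms(1,2) by (auto simp: subregions_def size_of_def)
  have meas: "{x \<in> space ?N. f x \<le> y} \<in> sets ?N" using assms(3) by measurable
  have eq: "\<sigma> k i \<inter> {x \<in> space ?N. f x \<le> y} = {x \<in> \<sigma> k i. f x \<le> y}"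
    using sets.sets_into_space[OF \<sigma>] by auto
  have "emeasure ?N (\<sigma> k i) \<noteq> 0" "emeasure ?N (\<sigma> k i) \<noteq> \<infinity>"
    using pos by (auto simp: measure_def)
  then show ?thesis
    using \<sigma> meas eq assms(4)
    by (simp add: next_value_cdf_def uniform_rule_def size_below_def size_of_def min_le_iff_disj
        measure_uniform_measure)
qed

definition surrogate_improves ::
  "'a::euclidean_space set \<Rightarrow> ('a \<Rightarrow> real) \<Rightarrow> real \<Rightarrow> real \<Rightarrow> (nat \<Rightarrow> nat) \<Rightarrow>
   (nat \<Rightarrow> nat \<Rightarrow> 'a set) \<Rightarrow> (nat \<Rightarrow> nat \<Rightarrow> real \<Rightarrow> 'a measure) \<Rightarrow> bool" where
  "surrogate_improves S f ymin ymax m \<sigma> Q \<longleftrightarrow> (\<forall>k. \<forall>i\<in>{1..m k}.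
     (\<forall>y z. ymin < y \<and> y \<le> z \<and> z \<le> ymax \<longrightarrow>
        next_value_cdf f Q k i z y \<ge> next_value_cdf f (uniform_rule S \<sigma>) k i z y) \<and>
     (\<forall>y z z'. ymin < y \<and> y \<le> z \<and> z \<le> z' \<and> z' \<le> ymax \<longrightarrow>
        next_value_cdf f Q k i z y \<ge> next_value_cdf f Q k i z' y))"

text \<open>
  A run of the algorithm on a probability space \<open>M\<close>: \<open>X k\<close> are the sampled points, \<open>Y k\<close> the
  incumbent values and \<open>I k\<close> the index of the subregion from which \<open>X (Suc k)\<close> is drawn.
  The last clause says \<open>P(I k = i, X (Suc k) \<in> A | Y k = z) = p k i z * Q k i z A\<close> for
  \<open>z > ymin\<close>. Conditioning is on \<open>Y k\<close> alone, so the sampling may depend on the whole history.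
  Once \<open>Y k = ymin\<close>, the process stays there whatever is sampled.
\<close>

definition basso_run ::
  "'a::euclidean_space set \<Rightarrow> ('a \<Rightarrow> real) \<Rightarrow> real \<Rightarrow> (nat \<Rightarrow> nat) \<Rightarrow>
   (nat \<Rightarrow> nat \<Rightarrow> real \<Rightarrow> real) \<Rightarrow> (nat \<Rightarrow> nat \<Rightarrow> real \<Rightarrow> 'a measure) \<Rightarrow>
   'w measure \<Rightarrow> (nat \<Rightarrow> 'w \<Rightarrow> nat) \<Rightarrow> (nat \<Rightarrow> 'w \<Rightarrow> 'a) \<Rightarrow> (nat \<Rightarrow> 'w \<Rightarrow> real) \<Rightarrow> bool" where
  "basso_run S f ymin m p Q M I X Y \<longleftrightarrow>
     prob_space M \<and>
     (\<forall>k. I k \<in> M \<rightarrow>\<^sub>M count_space {1..m k}) \<and>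
     (\<forall>k. X k \<in> M \<rightarrow>\<^sub>M size_measure S) \<and>
     distr M (size_measure S) (X 0) = uniform_measure (size_measure S) S \<and>
     (\<forall>w\<in>space M. Y 0 w = f (X 0 w)) \<and>
     (\<forall>k. \<forall>w\<in>space M. Y (Suc k) w = min (Y k w) (f (X (Suc k) w))) \<and>
     (\<forall>k. \<forall>i\<in>{1..m k}. \<forall>A\<in>sets (size_measure S). AE w in M. ymin < Y k w \<longrightarrow>
        real_cond_exp M (vimage_algebra (space M) (Y k) borel)
          (indicator {w \<in> space M. I k w = i \<and> X (Suc k) w \<in> A}) w
        = p k i (Y k w) * measure (Q k i (Y k w)) A)"

end

theory Submission
  imports Defs
begin

text \<open>
  At \<open>z = y\<^sup>*\<close> the denominators in Assumption 1(3) are both \<open>1\<close>, so the assumption says that the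
  mixture distribution function is antitone in the incumbent value. Hence, for fixed \<open>y\<close>,
  the one-step probability \<open>h z = P(Y\<^sub>k\<^sub>+\<^sub>1 \<le> y | Y\<^sub>k = z)\<close> of the uniform version is antitone
  in \<open>z\<close>, and by Assumption 2(1) the surrogate version has a pointwise larger one. Write \<open>U\<^sub>k\<close> and
  \<open>V\<^sub>k\<close> for the uniform and the surrogate incumbent. By induction on \<open>k\<close>,
  \<open>P(V\<^sub>k\<^sub>+\<^sub>1 \<le> y) \<ge> E h(V\<^sub>k) \<ge> E h(U\<^sub>k) = P(U\<^sub>k\<^sub>+\<^sub>1 \<le> y)\<close>, where the middle step is stochastic
  dominance at time \<open>k\<close>.
\<close>

section \<open>Stochastic dominance and expectations of antitone functions\<close>

text \<open>A down-closed set of reals is empty, everything, \<open>{..a}\<close> or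
  \<open>{..<a}\<close>. The distribution functions compare the closed ray directly, and the open
  ray by continuity from below. They are compared only from \<open>c\<close> upwards, so a nonempty
  \<open>D\<close> has to contain \<open>c\<close>: then its endpoint is not below
  \<open>c\<close>.\<close>

lemma down_closed_measure_le:
  fixes A :: "'v \<Rightarrow> real" and B :: "'w \<Rightarrow> real"
  assumes "prob_space M" "prob_space N"
    and A [measurable]: "A \<in> borel_measurable M" and B [measurable]: "B \<in> borel_measurable N"
    and le: "\<And>x. c \<le> x \<Longrightarrow> \<P>(w in N. B w \<le> x) \<le> \<P>(w in M. A w \<le> x)"
    and down: "\<And>x x'. x' \<in> D \<Longrightarrow> x \<le> x' \<Longrightarrow> x \<in> D"
    and c: "D = {} \<or> c \<in> D"
  shows "\<P>(w in N. B w \<in> D) \<le> \<P>(w in M. A w \<in> D)"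
proof -
  interpret M: prob_space M by fact
  interpret N: prob_space N by fact
  consider "D = {}" | "D = UNIV" | "D \<noteq> {}" "D \<noteq> UNIV" by blast
  then show ?thesis
  proof cases
    case 3
    then have cD: "c \<in> D" using c by simp
    from 3 obtain u where u: "u \<notin> D" by blast
    have bdd: "bdd_above D" using u down by (meson bdd_aboveI linear)
    define a where "a = Sup D"
    have le_a: "x \<le> a" if "x \<in> D" for x unfolding a_def using that bdd by (rule cSup_upper)
    have less_a: "x \<in> D" if "x < a" for x
      using that less_cSup_iff[OF 3(1) bdd, of x] down unfolding a_def by (meson less_imp_le)
    show ?thesis
    proof (cases "a \<in> D")
      case True
      then have "D = {..a}" using le_a down by auto
      then show ?thesis using le[of a] le_a[OF cD] by simp
    next
      case False
      have ca: "c < a" using cD False le_a[OF cD] by (cases "c = a") auto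
      \<comment> \<open>Thresholds increasing to \<open>a\<close>. The maximum with \<open>c\<close>
        keeps them in the range of \<open>le\<close>, and \<open>c < a\<close> keeps them strictly
        below \<open>a\<close>.\<close>
      define r where "r n = max c (a - 1 / real (Suc n))" for n
      have r_less: "r n < a" for n using ca by (simp add: r_def)
      have ex: "\<exists>n. x \<le> r n" if "x < a" for x
      proof -
        obtain n where "inverse (real (Suc n)) < a - x" using reals_Archimedean[of "a - x"] \<open>x < a\<close> by auto
        then have "x \<le> r n" by (simp add: r_def inverse_eq_divide)
        then show ?thesis ..
      qed
      have D: "D = (\<Union>n. {..r n})"
      proof (intro set_eqI iffI)
        fix x assume "x \<in> D"
        then have "x < a" using le_a False by (metis order_le_less)
        then show "x \<in> (\<Union>n. {..r n})" using ex by blast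
      next
        fix x assume "x \<in> (\<Union>n. {..r n})"
        then show "x \<in> D" using r_less less_a by (auto intro: le_less_trans)
      qed
      have "incseq r"
        unfolding r_def by (intro incseq_SucI max.mono diff_mono order.refl) (simp add: frac_le)
      then have mono: "r i \<le> r j" if "i \<le> j" for i j using that by (simp add: incseq_def)
      have "(\<lambda>n. \<P>(w in N. B w \<le> r n)) \<longlonglongrightarrow> N.prob (\<Union>n. {w \<in> space N. B w \<le> r n})"
        using mono by (intro N.finite_Lim_measure_incseq) (auto simp: incseq_def intro: order.trans)
      moreover have "(\<lambda>n. \<P>(w in M. A w \<le> r n)) \<longlonglongrightarrow> M.prob (\<Union>n. {w \<in> space M. A w \<le> r n})"
        using mono by (intro M.finite_Lim_measure_incseq) (auto simp: incseq_def intro: order.trans)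
      moreover have "\<P>(w in N. B w \<le> r n) \<le> \<P>(w in M. A w \<le> r n)" for n
        by (rule le) (simp add: r_def)
      ultimately have "N.prob (\<Union>n. {w \<in> space N. B w \<le> r n}) \<le> M.prob (\<Union>n. {w \<in> space M. A w \<le> r n})"
        by (blast intro: LIMSEQ_le)
      moreover have "(\<Union>n. {w \<in> space N. B w \<le> r n}) = {w \<in> space N. B w \<in> D}"
        "(\<Union>n. {w \<in> space M. A w \<le> r n}) = {w \<in> space M. A w \<in> D}"
        by (auto simp: D)
      ultimately show ?thesis by simp
    qed
  qed (simp_all add: M.prob_space N.prob_space)
qed

text \<open>Tonelli for the region \<open>0 \<le> t < g w\<close>: its section at \<open>w\<close>
  has length \<open>g w\<close>, its section at \<open>t\<close> is a superlevel set of
  \<open>g\<close>. Where \<open>g\<close> is negative, the section is empty and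
  \<open>ennreal\<close> truncates to \<open>0\<close>.\<close>

lemma nn_integral_layer_cake:
  fixes g :: "'a \<Rightarrow> real"
  assumes "sigma_finite_measure M" and [measurable]: "g \<in> borel_measurable M"
  shows "(\<integral>\<^sup>+w. ennreal (g w) \<partial>M)
    = (\<integral>\<^sup>+t. indicator {0..} t * emeasure M {w \<in> space M. t < g w} \<partial>lborel)"
proof -
  interpret sigma_finite_measure M by fact
  interpret pair_sigma_finite M lborel ..
  have "(\<integral>\<^sup>+w. ennreal (g w) \<partial>M) = (\<integral>\<^sup>+w. (\<integral>\<^sup>+t. indicator {(w, t). 0 \<le> t \<and> t < g w} (w, t) \<partial>lborel) \<partial>M)"
  proof (rule nn_integral_cong)
    fix w
    have "(\<integral>\<^sup>+t. indicator {(w, t). 0 \<le> t \<and> t < g w} (w, t) \<partial>lborel)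
        = (\<integral>\<^sup>+t. indicator {0..<g w} t \<partial>lborel)"
      by (intro nn_integral_cong) (auto simp: indicator_def)
    also have "\<dots> = ennreal (g w)" by (cases "0 \<le> g w") (auto simp: ennreal_neg)
    finally show "ennreal (g w) = (\<integral>\<^sup>+t. indicator {(w, t). 0 \<le> t \<and> t < g w} (w, t) \<partial>lborel)" ..
  qed
  also have "\<dots> = (\<integral>\<^sup>+t. (\<integral>\<^sup>+w. indicator {(w, t). 0 \<le> t \<and> t < g w} (w, t) \<partial>M) \<partial>lborel)"
    by (rule Fubini'[symmetric]) measurable
  also have "\<dots> = (\<integral>\<^sup>+t. indicator {0..} t * emeasure M {w \<in> space M. t < g w} \<partial>lborel)"
  proof (rule nn_integral_cong)
    fix t :: real
    have "(\<integral>\<^sup>+w. indicator {(w, t). 0 \<le> t \<and> t < g w} (w, t) \<partial>M)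
        = (\<integral>\<^sup>+w. indicator {0..} t * indicator {w \<in> space M. t < g w} w \<partial>M)"
      by (intro nn_integral_cong) (auto simp: indicator_def)
    then show "(\<integral>\<^sup>+w. indicator {(w, t). 0 \<le> t \<and> t < g w} (w, t) \<partial>M)
        = indicator {0..} t * emeasure M {w \<in> space M. t < g w}"
      by (simp add: nn_integral_cmult)
  qed
  finally show ?thesis .
qed

text \<open>Superlevel sets of an antitone function are down-closed, so the two expectations can be
  compared level by level in the layer cake formula. The bound \<open>h z \<le> h c\<close> puts
  \<open>c\<close> into every nonempty superlevel set, so that no comparison below \<open>c\<close>
  is called for.\<close>

lemma integral_antimono_le:
  fixes A :: "'v \<Rightarrow> real" and B :: "'w \<Rightarrow> real" and h :: "real \<Rightarrow> real"
  assumes "prob_space M" "prob_space N"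
    and A [measurable]: "A \<in> borel_measurable M" and B [measurable]: "B \<in> borel_measurable N"
    and le: "\<And>x. c \<le> x \<Longrightarrow> \<P>(w in N. B w \<le> x) \<le> \<P>(w in M. A w \<le> x)"
    and h: "antimono h" "\<And>z. 0 \<le> h z" "\<And>z. h z \<le> h c"
  shows "(\<integral>w. h (B w) \<partial>N) \<le> (\<integral>w. h (A w) \<partial>M)"
proof -
  interpret M: prob_space M by fact
  interpret N: prob_space N by fact
  have "(\<lambda>x. - h x) \<in> borel_measurable borel"
    using h(1) by (intro borel_measurable_mono) (auto simp: mono_def antimono_def)
  then have [measurable]: "h \<in> borel_measurable borel" using borel_measurable_uminus_eq by blast
  have "(\<integral>\<^sup>+w. ennreal (h (B w)) \<partial>N) \<le> (\<integral>\<^sup>+w. ennreal (h (A w)) \<partial>M)"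
  proof (subst (1 2) nn_integral_layer_cake)
    have "\<P>(w in N. B w \<in> {x. t < h x}) \<le> \<P>(w in M. A w \<in> {x. t < h x})" for t
      using h(1) h(3)
      by (intro down_closed_measure_le[OF assms(1-4) le])
        (auto simp: antimono_def intro: less_le_trans)
    then show "(\<integral>\<^sup>+t. indicator {0..} t * emeasure N {w \<in> space N. t < h (B w)} \<partial>lborel)
        \<le> (\<integral>\<^sup>+t. indicator {0..} t * emeasure M {w \<in> space M. t < h (A w)} \<partial>lborel)"
      by (intro nn_integral_mono mult_left_mono)
        (auto simp: M.emeasure_eq_measure N.emeasure_eq_measure)
  qed (auto intro: M.sigma_finite_measure_axioms N.sigma_finite_measure_axioms)
  \<comment> \<open>Boundedness by \<open>h c\<close> makes the Bochner integrals agree with the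
    nonnegative ones just compared.\<close>
  moreover have "integrable N (\<lambda>w. h (B w))"
    using h by (intro N.integrable_const_bound[of _ "h c"]) auto
  moreover have "integrable M (\<lambda>w. h (A w))"
    using h by (intro M.integrable_const_bound[of _ "h c"]) auto
  ultimately show ?thesis
    using h(2) by (simp add: nn_integral_eq_integral integral_nonneg_AE)
qed

section \<open>Runs of the algorithm and their one-step probabilities\<close>

lemma space_size_measure [simp]: "space (size_measure S) = S"
  by (simp add: size_measure_def space_restrict_space)

lemma basso_run_measurable_incumbent:
  assumes f: "f \<in> borel_measurable (size_measure S)" and run: "basso_run S f ymin m p Q M I X Y"
  shows "Y k \<in> borel_measurable M"
proof -
  have X: "(\<lambda>w. f (X j w)) \<in> borel_measurable M" for j
    using run by (intro measurable_compose[OF _ f]) (simp add: basso_run_def)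
  show ?thesis
  proof (induction k)
    case 0
    then show ?case using run X[of 0] by (subst measurable_cong) (auto simp: basso_run_def)
  next
    case (Suc k)
    then have "(\<lambda>w. min (Y k w) (f (X (Suc k) w))) \<in> borel_measurable M"
      using X by measurable
    then show ?case using run by (subst measurable_cong) (auto simp: basso_run_def)
  qed
qed

lemma basso_run_incumbent_le:
  assumes "\<forall>x\<in>S. f x \<le> ymax" and run: "basso_run S f ymin m p Q M I X Y" and w: "w \<in> space M"
  shows "Y k w \<le> ymax"
proof (induction k)
  case 0
  have "X 0 w \<in> S" using run w measurable_space[of "X 0" M "size_measure S"] by (simp add: basso_run_def)
  then show ?case using assms by (simp add: basso_run_def)
next
  case (Suc k)
  then show ?case using run w by (simp add: basso_run_def)
qed

text \<open>Level \<open>y\<close> is reached at the next step either because the incumbent is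
  already there, or because the new sample falls there; the second event has its conditional
  probability given \<open>Y k\<close> prescribed by the run. The integrand is an integrable
  \<open>g\<close> that agrees almost everywhere with the explicit formula, which spares a
  measurability argument for that formula.\<close>

lemma basso_run_step:
  fixes f :: "'a::euclidean_space \<Rightarrow> real"
  assumes f: "f \<in> borel_measurable (size_measure S)"
    and run: "basso_run S f ymin m p Q M I X Y" and y: "ymin < y"
  obtains g where "integrable M g"
    and "\<P>(w in M. Y (Suc k) w \<le> y) = (\<integral>w. g w \<partial>M)"
    and "AE w in M. g w = (if Y k w \<le> y then 1 else
           \<Sum>i = 1..m k. p k i (Y k w) * measure (Q k i (Y k w)) {x \<in> S. f x \<le> y})"
proof -
  interpret prob_space M using run by (simp add: basso_run_def)
  note [measurable] = basso_run_measurable_incumbent[OF f run]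
  define F where "F = vimage_algebra (space M) (Y k) borel"
  define A where "A = {x \<in> S. f x \<le> y}"
  define E where "E i = {w \<in> space M. I k w = i \<and> X (Suc k) w \<in> A}" for i
  define G where "G = {w \<in> space M. y < Y k w}"
  define C where "C i = real_cond_exp M F (indicator (E i))" for i
  have "subalgebra M F"
    unfolding subalgebra_def F_def
    using sets_image_in_sets[OF refl basso_run_measurable_incumbent[OF f run]] by simp
  then interpret finite_measure_subalgebra M F
    by unfold_locales
  have A_sets: "A \<in> sets (size_measure S)"
    using borel_measurable_le[OF f measurable_const, of y] by (simp add: A_def)
  have X: "X (Suc k) \<in> M \<rightarrow>\<^sub>M size_measure S" and I: "I k \<in> M \<rightarrow>\<^sub>M count_space {1..m k}"
    using run by (auto simp: basso_run_def)
  have E_eq: "E i = (I k -` {i} \<inter> space M) \<inter> (X (Suc k) -` A \<inter> space M)" for i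
    by (auto simp: E_def)
  have E [measurable]: "E i \<in> sets M" if "i \<in> {1..m k}" for i
    unfolding E_eq using that
    by (intro sets.Int measurable_sets[OF X A_sets] measurable_sets[OF I]) auto
  \<comment> \<open>\<open>G\<close> depends on \<open>Y k\<close> alone, so the conditional
    expectation given \<open>F\<close> may be integrated over it.\<close>
  have G_F: "G \<in> sets F"
    using in_vimage_algebra[of "{y<..}" borel "Y k" "space M"]
    by (simp add: F_def G_def vimage_def Int_def conj_commute)
  have G [measurable]: "G \<in> sets M" unfolding G_def by measurable
  have int_E: "integrable M (indicator (E i) :: _ \<Rightarrow> real)" if "i \<in> {1..m k}" for i
    using E[OF that] by (simp add: integrable_indicator_iff emeasure_eq_measure)
  have int_C: "integrable M (\<lambda>w. indicator G w * C i w)" if "i \<in> {1..m k}" for i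
    using integrable_mult_indicator[OF G real_cond_exp_int(1)[OF int_E[OF that]]] by (simp add: C_def)
  have integral_C: "(\<integral>w. indicator G w * C i w \<partial>M) = prob (G \<inter> E i)" if "i \<in> {1..m k}" for i
  proof -
    have "(\<integral>w. indicator G w * C i w \<partial>M) = (\<integral>w. indicator G w * indicator (E i) w \<partial>M)"
      using real_cond_exp_intA[OF int_E[OF that] G_F] by (simp add: C_def set_lebesgue_integral_def)
    also have "\<dots> = (\<integral>w. indicator (G \<inter> E i) w \<partial>M)"
      by (simp add: indicator_inter_arith)
    also have "\<dots> = prob (G \<inter> E i)" using E[OF that] by simp
    finally show ?thesis .
  qed
  \<comment> \<open>\<open>G\<close> is the complement of the first event, so at each point only one
    of the two summands can be nonzero. This yields the case distinction in the formula for
    \<open>g\<close>.\<close>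
  define g where "g w = indicator {w \<in> space M. Y k w \<le> y} w + (\<Sum>i = 1..m k. indicator G w * C i w)" for w
  have int_low: "integrable M (indicator {w \<in> space M. Y k w \<le> y} :: _ \<Rightarrow> real)"
    by (simp add: integrable_indicator_iff emeasure_eq_measure)
  show ?thesis
  proof
    have int_sum: "integrable M (\<lambda>w. \<Sum>i = 1..m k. indicator G w * C i w)"
      using int_C by (rule Bochner_Integration.integrable_sum)
    with int_low show "integrable M g"
      unfolding g_def by (rule Bochner_Integration.integrable_add)
    \<comment> \<open>The events \<open>E i\<close> exhaust all ways to sample at or below level
      \<open>y\<close>, because \<open>I k\<close> takes its values in
      \<open>{1..m k}\<close>.\<close>
    have "{w \<in> space M. Y (Suc k) w \<le> y} = {w \<in> space M. Y k w \<le> y} \<union> (\<Union>i\<in>{1..m k}. G \<inter> E i)"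
      using run measurable_space[OF I] measurable_space[OF X]
      by (auto simp: basso_run_def G_def E_def A_def min_le_iff_disj)
    then have "\<P>(w in M. Y (Suc k) w \<le> y)
        = prob ({w \<in> space M. Y k w \<le> y} \<union> (\<Union>i\<in>{1..m k}. G \<inter> E i))"
      by simp
    also have "\<dots> = \<P>(w in M. Y k w \<le> y) + prob (\<Union>i\<in>{1..m k}. G \<inter> E i)"
      by (intro finite_measure_Union sets.finite_UN sets.Int) (auto simp: G_def E)
    also have "prob (\<Union>i\<in>{1..m k}. G \<inter> E i) = (\<Sum>i = 1..m k. prob (G \<inter> E i))"
      by (intro finite_measure_finite_Union) (auto simp: disjoint_family_on_def E_def[abs_def] intro!: sets.Int G E[unfolded E_def])
    also have "\<P>(w in M. Y k w \<le> y) + \<dots> = (\<integral>w. g w \<partial>M)"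
    proof -
      have "(\<integral>w. (\<Sum>i = 1..m k. indicator G w * C i w) \<partial>M) = (\<Sum>i = 1..m k. prob (G \<inter> E i))"
        using Bochner_Integration.integral_sum[OF int_C, of "{1..m k}"] integral_C by simp
      then show ?thesis
        using Bochner_Integration.integral_add[OF int_low int_sum] by (simp add: g_def Int_def conj_commute)
    qed
    finally show "\<P>(w in M. Y (Suc k) w \<le> y) = (\<integral>w. g w \<partial>M)" .
    \<comment> \<open>There are finitely many subregions, so one null set serves all of them. On
      \<open>G\<close> the premise \<open>ymin < Y k w\<close> holds because
      \<open>ymin < y\<close>.\<close>
    have "AE w in M. \<forall>i\<in>{1..m k}. ymin < Y k w \<longrightarrow>
        C i w = p k i (Y k w) * measure (Q k i (Y k w)) A"
      using run A_sets by (intro AE_finite_allI) (auto simp: basso_run_def C_def F_def E_def)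
    then show "AE w in M. g w = (if Y k w \<le> y then 1 else
        \<Sum>i = 1..m k. p k i (Y k w) * measure (Q k i (Y k w)) {x \<in> S. f x \<le> y})"
      using AE_space
    proof eventually_elim
      case (elim w)
      then show ?case using y by (auto simp: g_def G_def A_def intro!: sum.cong)
    qed
  qed
qed

text \<open>An incumbent above \<open>y\<close> cannot itself meet the level, so the minimum is
  decided by the new sample. This links the kernel in the run to the quantity in which the sampling
  assumptions are phrased.\<close>

lemma measure_eq_next_value_cdf:
  "space (Q k i z) = S \<Longrightarrow> y < z \<Longrightarrow> measure (Q k i z) {x \<in> S. f x \<le> y} = next_value_cdf f Q k i z y"
  by (simp add: next_value_cdf_def min_le_iff_disj)

theorem theorem2:
  fixes S :: "'a::euclidean_space set" and f :: "'a \<Rightarrow> real"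
    and xmin :: 'a and ymin ymax :: real
    and m :: "nat \<Rightarrow> nat" and \<sigma> :: "nat \<Rightarrow> nat \<Rightarrow> 'a set"
    and p :: "nat \<Rightarrow> nat \<Rightarrow> real \<Rightarrow> real"
    and Q :: "nat \<Rightarrow> nat \<Rightarrow> real \<Rightarrow> 'a measure"
    and Msurr :: "'v measure" and Isurr :: "nat \<Rightarrow> 'v \<Rightarrow> nat"
    and Xsurr :: "nat \<Rightarrow> 'v \<Rightarrow> 'a" and Ysurr :: "nat \<Rightarrow> 'v \<Rightarrow> real"
    and Munif :: "'w measure" and Iunif :: "nat \<Rightarrow> 'w \<Rightarrow> nat"
    and Xunif :: "nat \<Rightarrow> 'w \<Rightarrow> 'a" and Yunif :: "nat \<Rightarrow> 'w \<Rightarrow> real"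
  assumes "search_domain S"
    and "objective S f xmin ymin ymax"
    and "subregions S m \<sigma>"
    and "adaptive_probabilities S f ymin ymax m \<sigma> p"
    and "sampling_rule S ymin ymax m \<sigma> Q"
    and "surrogate_improves S f ymin ymax m \<sigma> Q"
    and "basso_run S f ymin m p Q Msurr Isurr Xsurr Ysurr"
    and "basso_run S f ymin m p (uniform_rule S \<sigma>) Munif Iunif Xunif Yunif"
  shows "\<forall>k y. ymin < y \<and> y \<le> ymax \<longrightarrow>
           \<P>(w in Msurr. Ysurr k w \<le> y) \<ge> \<P>(w in Munif. Yunif k w \<le> y)"
proof -
  let ?U = "uniform_rule S \<sigma>"
  note surr = assms(7) and unif = assms(8)
  interpret Ms: prob_space Msurr using surr by (simp add: basso_run_def)
  interpret Mu: prob_space Munif using unif by (simp add: basso_run_def)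
  have f: "f \<in> borel_measurable (size_measure S)" and f_le: "\<forall>x\<in>S. f x \<le> ymax"
    using assms(2) by (auto simp: objective_def)
  note meas [measurable] = basso_run_measurable_incumbent[OF f surr] basso_run_measurable_incumbent[OF f unif]
  note le_max = basso_run_incumbent_le[OF f_le surr] basso_run_incumbent_le[OF f_le unif]

  \<comment> \<open>The mixture distribution function of uniform draws\<close>
  let ?F = "mixture_cdf S f m \<sigma> p"
  have p_nonneg: "0 \<le> p k i t"
    if "i \<in> {1..m k}" "t \<in> {ymin<..ymax}" for k i t
    using assms(4) that by (auto simp: adaptive_probabilities_def)
  have p_sum: "(\<Sum>i = 1..m k. p k i t) = 1" if "t \<in> {ymin<..ymax}" for k t
    using assms(4) that by (auto simp: adaptive_probabilities_def)
  have size_pos: "0 < size_of S (\<sigma> k i)" and \<sigma>_sub: "\<sigma> k i \<subseteq> S" if "i \<in> {1..m k}" for k i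
    using assms(3) that unfolding subregions_def by blast+
  \<comment> \<open>The uniform rule ignores the incumbent, and truncation at \<open>z\<close> is
    invisible below \<open>z\<close>. Hence \<open>z\<close> may be any value above
    \<open>y\<close>, independent of the parameter \<open>t\<close>.\<close>
  have F_eq: "?F k t y = (\<Sum>i = 1..m k. p k i t * next_value_cdf f ?U k i z y)" if "y < z" for k t y z
    unfolding mixture_cdf_def
    by (intro sum.cong refl) (simp add: next_value_cdf_uniform[OF assms(3) _ f that])
  have F_max: "?F k t ymax = 1" if "t \<in> {ymin<..ymax}" for k t
  proof -
    have "size_below S f (\<sigma> k i) ymax = size_of S (\<sigma> k i)" if "i \<in> {1..m k}" for i
      using \<sigma>_sub[OF that] f_le by (auto simp: size_below_def intro!: arg_cong[of _ _ "size_of S"])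
    then have "?F k t ymax = (\<Sum>i = 1..m k. p k i t)"
      using size_pos unfolding mixture_cdf_def by (intro sum.cong refl) force
    then show ?thesis using p_sum[OF that] by simp
  qed
  have F_antimono: "?F k t' y \<le> ?F k t y" if "ymin < t" "t \<le> t'" "t' \<le> ymax" "ymin < y" "y \<le> ymax" for k t t' y
  proof -
    have "?F k t' y / ?F k t' ymax \<le> ?F k t y / ?F k t ymax"
    proof -
      have "ymin < t \<and> t \<le> t' \<and> t' \<le> ymax \<and> ymin < y \<and> y \<le> ymax \<and> ymax \<le> ymax \<and>
          0 < ?F k t ymax \<and> 0 < ?F k t' ymax"
        using that F_max[of t k] F_max[of t' k] by simp
      then show ?thesis using assms(4) unfolding adaptive_probabilities_def by blast
    qed
    then show ?thesis using that F_max[of t k] F_max[of t' k] by simp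
  qed
  have cdf_01: "0 \<le> next_value_cdf f ?U k i z y" "next_value_cdf f ?U k i z y \<le> 1" if "i \<in> {1..m k}" for k i z y
  proof -
    have "prob_space (?U k i z)" unfolding uniform_rule_def
      using size_pos[OF that] by (intro prob_space_uniform_measure) (auto simp: size_of_def measure_def)
    then show "0 \<le> next_value_cdf f ?U k i z y" "next_value_cdf f ?U k i z y \<le> 1"
      by (auto simp: next_value_cdf_def prob_space.prob_le_1)
  qed
  \<comment> \<open>Here and in the upper bound, \<open>y + 1\<close> is a dummy incumbent that lets
    \<open>F_eq\<close> apply.\<close>
  have F_nonneg: "0 \<le> ?F k t y" if "t \<in> {ymin<..ymax}" for k t y
    unfolding F_eq[OF less_add_one] using p_nonneg that cdf_01 by (intro sum_nonneg) auto
  have F_le_1: "?F k t y \<le> 1" if "t \<in> {ymin<..ymax}" for k t y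
  proof -
    have "?F k t y \<le> (\<Sum>i = 1..m k. p k i t * 1)"
      unfolding F_eq[OF less_add_one] using p_nonneg that cdf_01
      by (intro sum_mono mult_left_mono) auto
    then show ?thesis using p_sum[OF that] by simp
  qed
  have space_U: "space (?U k i z) = S" for k i z by (simp add: uniform_rule_def)
  have space_Q: "space (Q k i z) = S" if "i \<in> {1..m k}" "z \<in> {ymin<..ymax}" for k i z
  proof -
    have "Q k i z \<in> space (prob_algebra (size_measure S))"
      using assms(5) that by (auto simp: sampling_rule_def space_restrict_space dest!: spec[of _ k] bspec[of _ _ i]
        intro: measurable_space)
    then show ?thesis by (auto simp: space_prob_algebra dest: sets_eq_imp_space_eq)
  qed

  \<comment> \<open>Induction on the iteration\<close>
  \<comment> \<open>The bound \<open>y \<le> ymax\<close> is dropped: comparing integrals at level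
    \<open>y\<close> uses the induction hypothesis at all levels from \<open>y\<close> upwards,
    including those beyond \<open>ymax\<close>.\<close>
  have "\<P>(w in Munif. Yunif k w \<le> y) \<le> \<P>(w in Msurr. Ysurr k w \<le> y)" if "ymin < y" for k y
    using that
  proof (induction k arbitrary: y)
    case 0
    \<comment> \<open>The initial law depends on neither the sampling rule nor the run, so both
      versions start with equal probabilities.\<close>
    have *: "\<P>(w in M. Y 0 w \<le> y) = measure (uniform_measure (size_measure S) S) {x \<in> S. f x \<le> y}"
      if run: "basso_run S f ymin m p R M I X Y" for R M I X and Y :: "nat \<Rightarrow> 'x \<Rightarrow> real"
    proof -
      have X: "X 0 \<in> M \<rightarrow>\<^sub>M size_measure S" using run by (simp add: basso_run_def)
      have "{x \<in> S. f x \<le> y} \<in> sets (size_measure S)"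
        using borel_measurable_le[OF f measurable_const, of y] by simp
      then have "measure (distr M (size_measure S) (X 0)) {x \<in> S. f x \<le> y}
          = measure M (X 0 -` {x \<in> S. f x \<le> y} \<inter> space M)"
        by (rule measure_distr[OF X])
      also have "X 0 -` {x \<in> S. f x \<le> y} \<inter> space M = {w \<in> space M. Y 0 w \<le> y}"
        using run measurable_space[OF X] by (auto simp: basso_run_def)
      finally show ?thesis using run by (simp add: basso_run_def)
    qed
    show ?case by (simp add: *[OF surr] *[OF unif])
  next
    case (Suc k)
    show ?case
    proof (cases "y \<le> ymax")
      case False
      then have "{w \<in> space Msurr. Ysurr (Suc k) w \<le> y} = space Msurr"
        using le_max(1) by (auto intro: order.trans[of _ ymax])
      then show ?thesis by (simp add: Ms.prob_space)
    next
      case True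
      \<comment> \<open>Cut off at \<open>ymax\<close>, so that \<open>h\<close> is antitone on all reals and hence Borel.\<close>
      define h where "h z = (if z \<le> y then 1 else ?F k (min z ymax) y)" for z
      \<comment> \<open>The jump at \<open>y\<close> goes downwards because \<open>?F\<close> never
        exceeds \<open>1\<close>; beyond it \<open>F_antimono\<close> applies. Since
        \<open>h y = 1\<close> is the largest value, \<open>y\<close> can play the role of
        \<open>c\<close> in \<open>integral_antimono_le\<close>.\<close>
      have h: "antimono h" "0 \<le> h z" "h z \<le> h y" for z
        using Suc.prems True F_antimono F_nonneg F_le_1 by (auto simp: h_def antimono_def)
      then have "(\<lambda>x. - h x) \<in> borel_measurable borel"
        by (intro borel_measurable_mono) (auto simp: mono_def antimono_def)
      then have [measurable]: "h \<in> borel_measurable borel" using borel_measurable_uminus_eq by blast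
      obtain gu where gu: "integrable Munif gu"
        "\<P>(w in Munif. Yunif (Suc k) w \<le> y) = (\<integral>w. gu w \<partial>Munif)"
        "AE w in Munif. gu w = (if Yunif k w \<le> y then 1 else
           \<Sum>i = 1..m k. p k i (Yunif k w) * measure (?U k i (Yunif k w)) {x \<in> S. f x \<le> y})"
        using basso_run_step[OF f unif Suc.prems] .
      obtain gs where gs: "integrable Msurr gs"
        "\<P>(w in Msurr. Ysurr (Suc k) w \<le> y) = (\<integral>w. gs w \<partial>Msurr)"
        "AE w in Msurr. gs w = (if Ysurr k w \<le> y then 1 else
           \<Sum>i = 1..m k. p k i (Ysurr k w) * measure (Q k i (Ysurr k w)) {x \<in> S. f x \<le> y})"
        using basso_run_step[OF f surr Suc.prems] .
      have "(\<integral>w. gu w \<partial>Munif) = (\<integral>w. h (Yunif k w) \<partial>Munif)"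
      proof (rule integral_cong_AE)
        \<comment> \<open>Incumbents never exceed \<open>ymax\<close>, so the cutoff in
          \<open>h\<close> is inactive and \<open>h\<close> is exactly the uniform one-step
          probability.\<close>
        show "AE w in Munif. gu w = h (Yunif k w)"
          using gu(3) AE_space
        proof eventually_elim
          case (elim w)
          then show ?case using le_max(2)[of w k]
            by (auto simp: h_def F_eq[of y "Yunif k w"] measure_eq_next_value_cdf[where Q = ?U, OF space_U] min_absorb1)
        qed
      qed (use gu(1) in auto)
      also have "\<dots> \<le> (\<integral>w. h (Ysurr k w) \<partial>Msurr)"
        using Suc.IH Suc.prems h
        by (intro integral_antimono_le[OF Ms.prob_space_axioms Mu.prob_space_axioms, of _ _ y]) auto
      also have "\<dots> \<le> (\<integral>w. gs w \<partial>Msurr)"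
      proof (rule integral_mono_AE)
        show "integrable Msurr (\<lambda>w. h (Ysurr k w))"
          using h by (intro Ms.integrable_const_bound[of _ "h y"]) auto
        show "AE w in Msurr. h (Ysurr k w) \<le> gs w"
          using gs(3) AE_space
        proof eventually_elim
          case (elim w)
          let ?z = "Ysurr k w"
          show ?case
          proof (cases "?z \<le> y")
            case False
            then have z: "?z \<in> {ymin<..ymax}" "y < ?z" using le_max(1) elim Suc.prems by auto
            have "h ?z = (\<Sum>i = 1..m k. p k i ?z * next_value_cdf f ?U k i ?z y)"
              using z by (simp add: h_def F_eq[of y ?z] min_absorb1)
            \<comment> \<open>Both versions select subregions with the same nonnegative weights at
              the same incumbent, so the surrogate and uniform draws are compared one subregion at a
              time.\<close>
            also have "\<dots> \<le> (\<Sum>i = 1..m k. p k i ?z * next_value_cdf f Q k i ?z y)"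
              using assms(6) p_nonneg z Suc.prems by (intro sum_mono mult_left_mono) (auto simp: surrogate_improves_def)
            also have "\<dots> = gs w"
              using z elim by (auto simp: measure_eq_next_value_cdf[where Q = Q, OF space_Q] intro!: sum.cong)
            finally show ?thesis .
          qed (use elim in \<open>simp add: h_def\<close>)
        qed
      qed (use gs in auto)
      finally show ?thesis using gu(2) gs(2) by simp
    qed
  qed
  then show ?thesis by blast
qed

end
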